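(* Let $d>2$ be an integer and let $p$ be a prime. For all $\vec{t}=(t_1,\dots,t_{d-1},1)\in\mathbb{Z}_p^d$ we have $$h_p(\vec{t})\ \le\ e(d-1)\,\frac{p\,\lceil\log p\rceil}{2\,h_p^*(\vec{t})},$$ where $e$ is the base of the natural logarithm; in particular $h_p(\vec t)\ll \dfrac{p\log p}{h_p^*(\vec t)}$, with an implied constant depending only on $d$.
   Context: $\mathbb{Z}_p=\mathbb{Z}/p\mathbb{Z}$ and $\log$ is the natural logarithm. For $\vec t=(t_1,\dots,t_{d-1},1)\in\mathbb{Z}_p^d$ define $$h_p(\vec{t}):=\min_{0<a<p}\ \max\big((at_1)\bmod p,\dots,(at_{d-1})\bmod p,\ a\big),$$ where $a$ ranges over integers and $m\bmod p$ denotes the representative in $\{0,1,\dots,p-1\}$. The dual height is $$h_p^*(\vec{t}):=\min_{\substack{\vec\alpha\in\mathbb{Z}_p^d,\ \vec\alpha\neq\vec 0\\ \vec\alpha\cdot\vec t\equiv 0 \ (\mathrm{mod}\ p)}}\ \max_{1\le i\le d}|\alpha_i|,$$ where for $x\in\mathbb{Z}_p$, $|x|$ denotes the smallest absolute value of an integer representing $x$. *)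

theory Defs
  imports Complex_Main "HOL-Number_Theory.Residues" "HOL-Library.FuncSet"
begin

text \<open>Elements of \<open>\<int>\<^sub>p\<close> are those of the library's \<open>residue_ring p\<close>, that is, the integers
  \<open>0, \<dots>, p - 1\<close>. Coordinates are indexed by \<open>1, \<dots>, d\<close>, and vectors are extensional functions, so
  that each vector is represented exactly once and the minimum in \<open>dual_height\<close> is over a
  finite set.\<close>

definition Zp_vecs :: "nat \<Rightarrow> nat \<Rightarrow> (nat \<Rightarrow> int) set" where
  "Zp_vecs p d = ({1..d} \<rightarrow>\<^sub>E carrier (residue_ring (int p)))"

text \<open>The last coordinate of \<open>t\<close> is \<open>1\<close> in all uses, and contributes the entry \<open>a\<close> itself.\<close>

definition height :: "nat \<Rightarrow> nat \<Rightarrow> (nat \<Rightarrow> int) \<Rightarrow> int" where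
  "height p d t =
     (MIN a\<in>{0<..<int p}. Max (insert a ((\<lambda>i. (a * t i) mod int p) ` {1..d - 1})))"

definition res_abs :: "nat \<Rightarrow> int \<Rightarrow> nat" where
  "res_abs p x = (LEAST n. \<exists>z::int. [z = x] (mod int p) \<and> n = nat \<bar>z\<bar>)"

definition dual_height :: "nat \<Rightarrow> nat \<Rightarrow> (nat \<Rightarrow> int) \<Rightarrow> nat" where
  "dual_height p d t =
     (MIN \<alpha>\<in>{\<alpha> \<in> Zp_vecs p d. (\<exists>i\<in>{1..d}. \<alpha> i \<noteq> 0) \<and>
                              [(\<Sum>i = 1..d. \<alpha> i * t i) = 0] (mod int p)}.
        MAX i\<in>{1..d}. res_abs p (\<alpha> i))"

end

theory Submission
  imports Defs "HOL-Library.Real_Mod" "HOL-Computational_Algebra.Polynomial"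
    "HOL-Analysis.Complex_Transcendental"
begin

text \<open>With \<open>\<chi>(x) = exp(2 \<pi> i x / p)\<close>, let \<open>f(x) = (\<Sum>j\<le>M. \<chi>(x)\<^sup>j)\<^sup>k\<close>, the Fourier transform of the
  \<open>k\<close>-fold convolution \<open>g\<close> of the indicator of \<open>{0, \<dots>, M}\<close>. Poisson summation equates the sum of
  \<open>\<Prod>f(\<alpha>\<^sub>i)\<close> over \<open>\<alpha>\<close> orthogonal to \<open>t\<close> with \<open>p\<^sup>d\<^sup>-\<^sup>1\<close> times the sum of \<open>\<Prod>g(a t\<^sub>i)\<close> over \<open>a\<close>. As
  \<open>g\<close> is supported on \<open>{0, \<dots>, k M}\<close>, only \<open>a = 0\<close> contributes to the latter sum if the height
  exceeds \<open>k M\<close>, and the sum is \<open>1\<close>.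

  For \<open>\<alpha> \<noteq> 0\<close> some coordinate is at least \<open>h\<^sup>*\<close> in absolute value, where the geometric sum is at most
  \<open>p / (2 h\<^sup>*) < (M + 1) / e\<close> if \<open>M = \<lfloor>e p / (2 h\<^sup>*)\<rfloor>\<close>. For \<open>k = (d - 1) \<lceil>log p\<rceil>\<close> the \<open>k\<close>-th power
  gains a factor \<open>p\<^sup>d\<^sup>-\<^sup>1\<close> over the term \<open>A = (M + 1)\<^sup>k\<^sup>d\<close> of \<open>\<alpha> = 0\<close>. As there are fewer than
  \<open>p\<^sup>d\<^sup>-\<^sup>1\<close> such terms, the sum over \<open>\<alpha>\<close> has modulus at least \<open>A / p\<^sup>d\<^sup>-\<^sup>1\<close>, and this exceeds \<open>p\<^sup>d\<^sup>-\<^sup>1\<close>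
  because \<open>(M + 1)\<^sup>k > e\<^sup>k \<ge> p\<^sup>d\<^sup>-\<^sup>1\<close>.\<close>

section \<open>Additive characters\<close>

definition addchar :: "nat \<Rightarrow> int \<Rightarrow> complex" where
  "addchar p x = cis (2 * pi * (of_int x / of_nat p))"

lemma norm_addchar [simp]: "norm (addchar p x) = 1"
  by (simp add: addchar_def)

lemma addchar_0 [simp]: "addchar p 0 = 1"
  by (simp add: addchar_def)

lemma addchar_add: "addchar p (x + y) = addchar p x * addchar p y"
  by (simp add: addchar_def cis_mult add_divide_distrib distrib_left)

lemma addchar_sum: "addchar p (\<Sum>i\<in>I. f i) = (\<Prod>i\<in>I. addchar p (f i))"
  by (induction I rule: infinite_finite_induct) (simp_all add: addchar_add)

lemma addchar_power: "addchar p x ^ n = addchar p (int n * x)"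
  by (simp only: addchar_def Complex.DeMoivre) (simp add: mult_ac)

lemma addchar_eq_1_iff:
  assumes "p > 0"
  shows "addchar p x = 1 \<longleftrightarrow> int p dvd x"
proof -
  have "addchar p x = 1 \<longleftrightarrow> (\<exists>n. real_of_int x = of_int n * of_nat p)"
    using assms by (auto simp: addchar_def cis_eq_1_iff field_simps)
  also have "\<dots> \<longleftrightarrow> (\<exists>n. x = n * int p)"
    by (metis of_int_eq_iff of_int_mult of_int_of_nat_eq)
  also have "\<dots> \<longleftrightarrow> int p dvd x"
    by (auto simp: dvd_def mult.commute)
  finally show ?thesis .
qed

lemma addchar_cong:
  assumes "p > 0" "[x = y] (mod int p)"
  shows "addchar p x = addchar p y"
proof -
  have "addchar p (x - y) = 1"
    using assms by (simp add: addchar_eq_1_iff cong_iff_dvd_diff)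
  then show ?thesis
    using addchar_add[of p "x - y" y] by simp
qed

lemma sum_addchar:
  assumes "p > 0"
  shows "(\<Sum>x\<in>{0..<int p}. addchar p (y * x)) = (if int p dvd y then of_nat p else 0)"
proof -
  have "(\<Sum>x\<in>{0..<int p}. addchar p (y * x)) = (\<Sum>n<p. addchar p y ^ n)"
    by (rule sum.reindex_bij_witness[of _ int nat]) (auto simp: addchar_power mult.commute)
  also have "\<dots> = (if addchar p y = 1 then of_nat p else (1 - addchar p y ^ p) / (1 - addchar p y))"
    by (simp add: sum_gp_strict)
  also have "addchar p y ^ p = 1"
    using assms by (simp add: addchar_power addchar_eq_1_iff)
  finally show ?thesis
    using assms by (simp add: addchar_eq_1_iff)
qed

section \<open>Distance of character values from 1\<close>

lemma sin_ge_linear: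
  fixes x :: real
  assumes "0 \<le> x" "x \<le> pi / 2"
  shows "sin x \<ge> 2 / pi * x"
proof -
  have "concave_on {0..pi/2} sin"
  proof (rule f''_le0_imp_concave)
    fix x :: real assume "x \<in> {0..pi/2}"
    then show "- sin x \<le> 0"
      by (simp add: sin_ge_zero)
  qed (auto intro!: derivative_eq_intros)
  \<comment> \<open>\<open>x\<close> is the convex combination of \<open>0\<close> and
    \<open>pi / 2\<close> with weight \<open>2 / pi * x\<close> on the latter, so the sine lies
    above its chord.\<close>
  from concave_onD[OF this, of "2 / pi * x" 0 "pi / 2"] show ?thesis
    using assms by (simp add: field_simps)
qed

text \<open>The chord from 1 to the point at angle 2 pi z / p has length 2 |sin (pi z / p)|, and the
  bound on \<open>z\<close> keeps pi |z| / p within the range of the linear bound for the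
  sine.\<close>

lemma norm_addchar_minus_1_ge:
  assumes "p > 0" "2 * \<bar>z\<bar> \<le> int p"
  shows "norm (addchar p z - 1) \<ge> 4 * \<bar>z\<bar> / p"
proof -
  define u where "u = pi * (\<bar>real_of_int z\<bar> / of_nat p)"
  have "norm (addchar p z - 1) = 2 * \<bar>sin (pi * (of_int z / of_nat p))\<bar>"
    using dist_exp_i_1[of "2 * pi * (of_int z / of_nat p)"]
    by (simp add: addchar_def cis_conv_exp)
  also have "\<bar>sin (pi * (of_int z / of_nat p))\<bar> = \<bar>sin u\<bar>"
    by (cases "z \<ge> 0") (simp_all add: u_def)
  finally have eq: "norm (addchar p z - 1) = 2 * \<bar>sin u\<bar>" .
  have "2 * \<bar>real_of_int z\<bar> \<le> real p"
    using assms(2) by linarith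
  then have "0 \<le> u" "u \<le> pi / 2"
    using assms(1) by (simp_all add: u_def field_simps)
  then have "2 / pi * u \<le> sin u"
    by (rule sin_ge_linear)
  then show ?thesis
    unfolding eq by (simp add: u_def)
qed

section \<open>Absolute values of residues\<close>

lemma res_abs_exists: "\<exists>z. [z = x] (mod int p) \<and> res_abs p x = nat \<bar>z\<bar>"
proof -
  have "\<exists>n. \<exists>z::int. [z = x] (mod int p) \<and> n = nat \<bar>z\<bar>"
    using cong_refl by blast
  from LeastI_ex[OF this] show ?thesis
    by (simp add: res_abs_def)
qed

lemma res_abs_le: "[z = x] (mod int p) \<Longrightarrow> res_abs p x \<le> nat \<bar>z\<bar>"
  unfolding res_abs_def by (rule Least_le) auto

lemma res_abs_le_half:
  assumes "p > 0"
  shows "2 * res_abs p x \<le> p"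
proof -
  define r where "r = x mod int p"
  have r: "0 \<le> r" "r < int p" "[r = x] (mod int p)"
    using assms by (auto simp: r_def cong_def)
  have "[r - int p = x] (mod int p)"
    using r(3) by (simp add: cong_def)
  \<comment> \<open>One of the representatives \<open>r\<close> and \<open>r - int p\<close> has
    absolute value at most p / 2.\<close>
  from res_abs_le[OF r(3)] res_abs_le[OF this] show ?thesis
    using r by linarith
qed

lemma res_abs_pos:
  assumes "x \<in> {0<..<int p}"
  shows "res_abs p x > 0"
proof (rule ccontr)
  assume "\<not> res_abs p x > 0"
  with res_abs_exists[of x p] have "[0 = x] (mod int p)"
    by auto
  with assms show False
    by (simp add: cong_def)
qed

text \<open>In the closed form of the geometric sum the numerator has modulus at most 2 and the
  denominator at least \<open>4 * \<bar>z\<bar> / p\<close>. The product form also covers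
  \<open>res_abs p x = 0\<close>.\<close>

lemma norm_geometric_addchar_le:
  assumes "p > 0"
  shows "norm (\<Sum>j\<le>M. addchar p x ^ j) * (2 * res_abs p x) \<le> p"
proof -
  obtain z where z: "[z = x] (mod int p)" "res_abs p x = nat \<bar>z\<bar>"
    using res_abs_exists by blast
  have eq: "addchar p x = addchar p z"
    using addchar_cong[OF assms z(1)] by simp
  let ?S = "\<Sum>j\<le>M. addchar p z ^ j"
  have "2 * \<bar>z\<bar> \<le> int p"
    using res_abs_le_half[OF assms, of x] z(2) by linarith
  from norm_addchar_minus_1_ge[OF assms this]
  have "norm ?S * (4 * \<bar>real_of_int z\<bar> / p) \<le> norm ?S * norm (addchar p z - 1)"
    by (rule mult_left_mono) simp
  also have "\<dots> = norm (addchar p z ^ Suc M - 1)"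
    using sum_gp_basic[of "addchar p z" M]
    by (metis mult.commute norm_minus_commute norm_mult)
  also have "\<dots> \<le> 2"
    using norm_triangle_ineq4[of "addchar p z ^ Suc M" 1] by (simp add: norm_power norm_mult)
  finally have "norm ?S * (2 * \<bar>real_of_int z\<bar>) \<le> p"
    using assms by (simp add: field_simps)
  then show ?thesis
    by (simp add: eq z(2))
qed

section \<open>Poisson summation on the orthogonal complement\<close>

text \<open>The vectors that compete in \<open>dual_height\<close>, with the zero vector added: the
  orthogonal complement of the line spanned by \<open>t\<close>.\<close>

definition orth :: "nat \<Rightarrow> nat \<Rightarrow> (nat \<Rightarrow> int) \<Rightarrow> (nat \<Rightarrow> int) set" where
  "orth p d t = {\<alpha> \<in> {1..d} \<rightarrow>\<^sub>E {0..<int p}. int p dvd (\<Sum>i=1..d. \<alpha> i * t i)}"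

lemma finite_orth: "finite (orth p d t)"
proof (rule finite_subset)
  show "orth p d t \<subseteq> {1..d} \<rightarrow>\<^sub>E {0..<int p}"
    unfolding orth_def by blast
qed (intro finite_PiE, auto)

text \<open>Expanding the product turns the left side into a sum over all vectors \<alpha>; summing
  over \<open>a\<close> first, orthogonality of characters keeps exactly those orthogonal to
  \<open>t\<close>.\<close>

lemma sum_orth:
  fixes f :: "int \<Rightarrow> complex"
  assumes "p > 0"
  shows "(\<Sum>a\<in>{0..<int p}. \<Prod>i=1..d. \<Sum>x\<in>{0..<int p}. f x * addchar p (- (a * t i) * x)) =
         of_nat p * (\<Sum>\<alpha>\<in>orth p d t. \<Prod>i=1..d. f (\<alpha> i))"
proof -
  let ?V = "{1..d} \<rightarrow>\<^sub>E {0..<int p}"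
  have "(\<Sum>a\<in>{0..<int p}. \<Prod>i=1..d. \<Sum>x\<in>{0..<int p}. f x * addchar p (- (a * t i) * x)) =
        (\<Sum>a\<in>{0..<int p}. \<Sum>\<alpha>\<in>?V. \<Prod>i=1..d. f (\<alpha> i) * addchar p (- (a * t i) * \<alpha> i))"
    by (intro sum.cong refl prod_sum_PiE) auto
  also have "\<dots> = (\<Sum>\<alpha>\<in>?V. \<Sum>a\<in>{0..<int p}. \<Prod>i=1..d. f (\<alpha> i) * addchar p (- (a * t i) * \<alpha> i))"
    by (rule sum.swap)
  also have "\<dots> = (\<Sum>\<alpha>\<in>?V. (\<Prod>i=1..d. f (\<alpha> i)) *
                     (\<Sum>a\<in>{0..<int p}. addchar p (- (\<Sum>i=1..d. \<alpha> i * t i) * a)))"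
    unfolding sum_distrib_left
    by (intro sum.cong refl)
       (simp add: prod.distrib sum_distrib_left sum_distrib_right mult_ac
             flip: addchar_sum sum_negf)
  also have "\<dots> = (\<Sum>\<alpha>\<in>?V. if int p dvd (\<Sum>i=1..d. \<alpha> i * t i)
                             then of_nat p * (\<Prod>i=1..d. f (\<alpha> i)) else 0)"
    unfolding sum_addchar[OF assms] by (intro sum.cong refl) simp
  also have "\<dots> = of_nat p * (\<Sum>\<alpha>\<in>orth p d t. \<Prod>i=1..d. f (\<alpha> i))"
    unfolding orth_def sum_distrib_left by (intro sum.inter_filter[symmetric] finite_PiE) auto
  finally show ?thesis .
qed

text \<open>Since \<open>t d = 1\<close>, orthogonality determines the last coordinate from the
  others.\<close>

lemma card_orth_le:
  assumes "d > 0" "t d = 1"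
  shows "card (orth p d t) \<le> p ^ (d - 1)"
proof -
  let ?r = "\<lambda>\<alpha>. restrict \<alpha> {1..d - 1}"
  have split: "{1..d} = insert d {1..d - 1}"
    using assms(1) by auto
  have "inj_on ?r (orth p d t)"
  proof (rule inj_onI)
    fix \<alpha> \<beta> assume \<alpha>: "\<alpha> \<in> orth p d t" and \<beta>: "\<beta> \<in> orth p d t" and eq: "?r \<alpha> = ?r \<beta>"
    have low: "\<alpha> i = \<beta> i" if "i \<in> {1..d - 1}" for i
      using fun_cong[OF eq, of i] that by simp
    have "int p dvd (\<Sum>i=1..d. \<alpha> i * t i) - (\<Sum>i=1..d. \<beta> i * t i)"
      using \<alpha> \<beta> by (auto simp: orth_def)
    also have "\<dots> = \<alpha> d - \<beta> d"
      using assms low unfolding split by simp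
    finally have "[\<alpha> d = \<beta> d] (mod int p)"
      by (simp add: cong_iff_dvd_diff)
    moreover have "\<alpha> d \<in> {0..<int p}" "\<beta> d \<in> {0..<int p}"
      using \<alpha> \<beta> assms(1) by (auto simp: orth_def)
    ultimately have "\<alpha> d = \<beta> d"
      by (simp add: cong_def)
    with low have "\<alpha> i = \<beta> i" if "i \<in> {1..d}" for i
      using that unfolding split by blast
    with \<alpha> \<beta> show "\<alpha> = \<beta>"
      unfolding orth_def by (auto intro: PiE_ext)
  qed
  moreover have "?r ` orth p d t \<subseteq> {1..d - 1} \<rightarrow>\<^sub>E {0..<int p}"
    by (auto simp: orth_def)
  ultimately have "card (orth p d t) \<le> card ({1..d - 1} \<rightarrow>\<^sub>E {0..<int p})"
    by (rule card_inj_on_le) (intro finite_PiE, auto)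
  then show ?thesis
    by (simp add: card_PiE)
qed

section \<open>Fourier transforms of powers of geometric sums\<close>

lemma power_geometric_expansion:
  "\<exists>c::nat \<Rightarrow> complex. c 0 = 1 \<and> (\<forall>z. (\<Sum>j\<le>M. z ^ j) ^ k = (\<Sum>n\<le>k * M. c n * z ^ n))"
proof -
  define P :: "complex poly" where "P = (\<Sum>j\<le>M. monom 1 j)"
  have poly_P: "poly P z = (\<Sum>j\<le>M. z ^ j)" for z
    by (simp add: P_def poly_sum poly_monom)
  have "degree P \<le> M"
    unfolding P_def by (rule degree_sum_le) (auto intro: order_trans[OF degree_monom_le])
  then have deg: "degree (P ^ k) \<le> k * M"
    using degree_power_le[of P k] by (metis le_trans mult.commute mult_le_mono2)
  have "(\<Sum>j\<le>M. z ^ j) ^ k = (\<Sum>n\<le>k * M. coeff (P ^ k) n * z ^ n)" for z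
  proof -
    have "(\<Sum>j\<le>M. z ^ j) ^ k = (\<Sum>n\<le>degree (P ^ k). coeff (P ^ k) n * z ^ n)"
      by (simp add: poly_P flip: poly_altdef)
    also have "\<dots> = (\<Sum>n\<le>k * M. coeff (P ^ k) n * z ^ n)"
      using deg by (intro sum.mono_neutral_left) (auto simp: coeff_eq_0)
    finally show ?thesis .
  qed
  \<comment> \<open>Coefficient \<open>n\<close> counts the ways to write \<open>n\<close> as an
    ordered sum of \<open>k\<close> integers from \<open>{0..M}\<close>; for 0 there is just
    one.\<close>
  moreover have "coeff (P ^ k) 0 = 1"
    by (simp add: coeff_0_power P_def coeff_sum sum.delta)
  ultimately show ?thesis
    by blast
qed

text \<open>Orthogonality keeps only exponents congruent to \<open>y\<close>. By
  \<open>k * M < p\<close> all exponents are already reduced, so nothing wraps around and at most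
  one survives.\<close>

lemma fourier_power_geometric:
  assumes "p > 0" "k * M < p"
    and c: "\<And>z. (\<Sum>j\<le>M. z ^ j) ^ k = (\<Sum>n\<le>k * M. c n * z ^ n)"
  shows "(\<Sum>x\<in>{0..<int p}. (\<Sum>j\<le>M. addchar p x ^ j) ^ k * addchar p (- y * x)) =
         of_nat p * (if y mod int p \<le> int (k * M) then c (nat (y mod int p)) else 0)"
proof -
  define r where "r = nat (y mod int p)"
  have r: "int r = y mod int p" "r < p"
    using assms(1) by (auto simp: r_def nat_less_iff)
  have dvd: "int p dvd int n - y \<longleftrightarrow> n = r" if "n \<le> k * M" for n
  proof -
    have "int p dvd int n - y \<longleftrightarrow> int n mod int p = y mod int p"
      by (simp add: mod_eq_dvd_iff)
    also have "int n mod int p = int n"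
      using that assms(2) by simp
    finally show ?thesis
      unfolding r(1)[symmetric] by simp
  qed
  have "(\<Sum>x\<in>{0..<int p}. (\<Sum>j\<le>M. addchar p x ^ j) ^ k * addchar p (- y * x)) =
        (\<Sum>x\<in>{0..<int p}. \<Sum>n\<le>k * M. c n * addchar p ((int n - y) * x))"
    unfolding c sum_distrib_right
    by (intro sum.cong refl) (simp add: addchar_power left_diff_distrib mult.assoc flip: addchar_add)
  also have "\<dots> = (\<Sum>n\<le>k * M. c n * (\<Sum>x\<in>{0..<int p}. addchar p ((int n - y) * x)))"
    by (subst sum.swap) (simp add: sum_distrib_left)
  also have "\<dots> = (\<Sum>n\<le>k * M. if n = r then c n * of_nat p else 0)"
    unfolding sum_addchar[OF assms(1)] by (intro sum.cong refl) (simp add: dvd)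
  also have "\<dots> = (if r \<le> k * M then c r * of_nat p else 0)"
    by (simp add: sum.delta)
  finally show ?thesis
    unfolding r(1)[symmetric] of_nat_le_iff by simp
qed

text \<open>By \<open>out\<close>, each nonzero \<open>a\<close> has a coordinate outside the
  support of \<open>?g\<close>, which kills its product. The term of \<open>a = 0\<close> is
  \<open>p ^ d\<close>, and one factor \<open>p\<close> cancels against that in
  \<open>sum_orth\<close>.\<close>

lemma sum_orth_power_geometric:
  assumes "p > 0" "d > 0" "k * M < p"
    and out: "\<And>a. a \<in> {0<..<int p} \<Longrightarrow> \<exists>i\<in>{1..d}. (a * t i) mod int p > int (k * M)"
  shows "(\<Sum>\<alpha>\<in>orth p d t. \<Prod>i=1..d. (\<Sum>j\<le>M. addchar p (\<alpha> i) ^ j) ^ k) = of_nat p ^ (d - 1)"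
proof -
  obtain c :: "nat \<Rightarrow> complex" where c0: "c 0 = 1"
    and c: "\<And>z. (\<Sum>j\<le>M. z ^ j) ^ k = (\<Sum>n\<le>k * M. c n * z ^ n)"
    using power_geometric_expansion by blast
  let ?g = "\<lambda>y. of_nat p * (if y mod int p \<le> int (k * M) then c (nat (y mod int p)) else 0)"
  have "of_nat p * (\<Sum>\<alpha>\<in>orth p d t. \<Prod>i=1..d. (\<Sum>j\<le>M. addchar p (\<alpha> i) ^ j) ^ k) =
        (\<Sum>a\<in>{0..<int p}. \<Prod>i=1..d. \<Sum>x\<in>{0..<int p}.
           (\<Sum>j\<le>M. addchar p x ^ j) ^ k * addchar p (- (a * t i) * x))"
    by (rule sum_orth[OF assms(1), symmetric])
  also have "\<dots> = (\<Sum>a\<in>{0..<int p}. \<Prod>i=1..d. ?g (a * t i))"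
    by (intro sum.cong prod.cong refl fourier_power_geometric assms(1,3) c)
  also have "{0..<int p} = insert 0 {0<..<int p}"
    using assms(1) by auto
  also have "(\<Sum>a\<in>\<dots>. \<Prod>i=1..d. ?g (a * t i)) = of_nat p ^ d"
  proof -
    have "(\<Prod>i=1..d. ?g (a * t i)) = 0" if a: "a \<in> {0<..<int p}" for a
    proof -
      from out[OF a] obtain i where "i \<in> {1..d}" "\<not> (a * t i) mod int p \<le> int (k * M)"
        by force
      then show ?thesis
        by (intro prod_zero) (auto intro!: bexI[of _ i])
    qed
    then have "(\<Sum>a\<in>{0<..<int p}. \<Prod>i=1..d. ?g (a * t i)) = 0"
      by (rule sum.neutral[rule_format])
    then show ?thesis
      by (subst sum.insert) (simp_all add: c0)
  qed
  finally show ?thesis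
    using assms(1,2) by (cases d) simp_all
qed

section \<open>The two heights\<close>

text \<open>As \<open>t d = 1\<close>, coordinate \<open>d\<close> of \<open>a * t\<close> is
  \<open>a\<close> itself, so one condition on all of \<open>{1..d}\<close> also covers the entry
  that \<open>height\<close> inserts separately.\<close>

lemma height_le:
  assumes "d > 0" "t d = 1" "a \<in> {0<..<int p}"
    and "\<And>i. i \<in> {1..d} \<Longrightarrow> (a * t i) mod int p \<le> B"
  shows "height p d t \<le> B"
proof -
  let ?m = "\<lambda>a. Max (insert a ((\<lambda>i. (a * t i) mod int p) ` {1..d - 1}))"
  have "height p d t \<le> ?m a"
    unfolding height_def by (rule Min_le) (use assms(3) in auto)
  also have "?m a \<le> B"
  proof (subst Max_le_iff)
    have "a \<le> B"
      using assms(4)[of d] assms(1-3) by simp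
    then show "\<forall>x\<in>insert a ((\<lambda>i. (a * t i) mod int p) ` {1..d - 1}). x \<le> B"
      using assms(4) by auto
  qed auto
  finally show ?thesis .
qed

lemma height_less:
  assumes "p \<ge> 2" "d > 0" "t d = 1"
  shows "height p d t < int p"
proof -
  have "height p d t \<le> int p - 1"
    by (rule height_le[where a = 1]) (use assms in auto)
  then show ?thesis
    by simp
qed

lemma carrier_residue_ring: "carrier (residue_ring (int p)) = {0..<int p}"
  by (auto simp: residue_ring_def)

lemma dual_height_orth:
  "dual_height p d t =
     (MIN \<alpha>\<in>{\<alpha> \<in> orth p d t. \<exists>i\<in>{1..d}. \<alpha> i \<noteq> 0}. MAX i\<in>{1..d}. res_abs p (\<alpha> i))"
  unfolding dual_height_def
  by (rule arg_cong[where f = Min], rule image_cong)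
     (auto simp: orth_def Zp_vecs_def carrier_residue_ring cong_0_iff)

lemma dual_height_le_res_abs:
  assumes "\<alpha> \<in> orth p d t" "\<exists>i\<in>{1..d}. \<alpha> i \<noteq> 0"
  shows "\<exists>i\<in>{1..d}. dual_height p d t \<le> res_abs p (\<alpha> i)"
proof -
  let ?m = "MAX i\<in>{1..d}. res_abs p (\<alpha> i)"
  have "dual_height p d t \<le> ?m"
    unfolding dual_height_orth by (rule Min_le) (use assms finite_orth in auto)
  moreover have "?m \<in> (\<lambda>i. res_abs p (\<alpha> i)) ` {1..d}"
    by (rule Max_in) (use assms(2) in auto)
  ultimately show ?thesis
    by auto
qed

lemma dual_height_bounds:
  assumes "p \<ge> 2" "d \<ge> 2" "t d = 1"
  shows "0 < dual_height p d t" "2 * dual_height p d t \<le> p"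
proof -
  let ?A = "{\<alpha> \<in> orth p d t. \<exists>i\<in>{1..d}. \<alpha> i \<noteq> 0}"
  \<comment> \<open>The vector (1, 0, ..., 0, -t_1) is orthogonal to \<open>t\<close> because
    \<open>t d = 1\<close>; it shows that the minimum is over a nonempty set and hence
    attained.\<close>
  define \<beta> where "\<beta> = (\<lambda>i\<in>{1..d}. if i = 1 then 1 else if i = d then (- t 1) mod int p else 0)"
  have split: "{1..d} = insert 1 (insert d {2..d - 1})"
    using assms(2) by auto
  have "(\<Sum>i=1..d. \<beta> i * t i) = t 1 + (- t 1) mod int p + (\<Sum>i=2..d - 1. \<beta> i * t i)"
    unfolding split using assms(2,3) by (simp add: \<beta>_def)
  also have "(\<Sum>i=2..d - 1. \<beta> i * t i) = 0"
    by (rule sum.neutral) (auto simp: \<beta>_def)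
  finally have "int p dvd (\<Sum>i=1..d. \<beta> i * t i)"
    by (simp add: dvd_eq_mod_eq_0 mod_add_right_eq)
  then have "\<beta> \<in> orth p d t"
    using assms(1) by (auto simp: orth_def \<beta>_def)
  moreover have "\<beta> 1 \<noteq> 0"
    using assms(2) by (simp add: \<beta>_def)
  ultimately have "\<beta> \<in> ?A"
    using assms(2) by (auto intro!: bexI[of _ 1])
  then have "dual_height p d t \<in> (\<lambda>\<alpha>. MAX i\<in>{1..d}. res_abs p (\<alpha> i)) ` ?A"
    unfolding dual_height_orth by (intro Min_in) (use finite_orth in auto)
  then obtain \<alpha> j where \<alpha>: "\<alpha> \<in> orth p d t" "j \<in> {1..d}" "\<alpha> j \<noteq> 0"
    and eq: "dual_height p d t = (MAX i\<in>{1..d}. res_abs p (\<alpha> i))"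
    by auto
  have "\<alpha> j \<in> {0<..<int p}"
    using \<alpha> by (force simp: orth_def PiE_iff)
  then have "0 < res_abs p (\<alpha> j)"
    by (rule res_abs_pos)
  also have "\<dots> \<le> dual_height p d t"
    unfolding eq by (rule Max_ge) (use \<alpha> in auto)
  finally show "0 < dual_height p d t" .
  have "dual_height p d t \<in> (\<lambda>i. res_abs p (\<alpha> i)) ` {1..d}"
    unfolding eq by (rule Max_in) (use \<alpha> in auto)
  then show "2 * dual_height p d t \<le> p"
    using res_abs_le_half[of p] assms(1) by auto
qed

section \<open>Comparison of the two heights\<close>

lemma norm_prod_power_geometric_le:
  assumes "p > 0" "j \<in> {1..d}" "0 < h" "h \<le> res_abs p (\<alpha> j)"
  shows "norm (\<Prod>i=1..d. (\<Sum>l\<le>M. addchar p (\<alpha> i) ^ l) ^ k)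
           \<le> (real p / (2 * real h)) ^ k * (real (M + 1) ^ k) ^ (d - 1)"
proof -
  let ?S = "\<lambda>i. \<Sum>l\<le>M. addchar p (\<alpha> i) ^ l"
  have S: "norm (?S i) \<le> real (M + 1)" for i
    using sum_norm_bound[of "{..M}" "\<lambda>l. addchar p (\<alpha> i) ^ l" 1] by (simp add: norm_power)
  have "norm (?S j) * (2 * real h) \<le> norm (?S j) * (2 * res_abs p (\<alpha> j))"
    using assms(4) by (intro mult_left_mono) auto
  also have "\<dots> \<le> p"
    using norm_geometric_addchar_le[OF assms(1)] by simp
  finally have Sj: "norm (?S j) \<le> real p / (2 * real h)"
    using assms(3) by (simp add: field_simps)
  \<comment> \<open>Only coordinate \<open>j\<close> is estimated by cancellation; the other
    \<open>d - 1\<close> get the trivial bound by the number of terms.\<close>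
  have "norm (\<Prod>i=1..d. ?S i ^ k) = norm (?S j) ^ k * (\<Prod>i\<in>{1..d} - {j}. norm (?S i) ^ k)"
    using assms(2) by (simp add: prod.remove norm_mult norm_power flip: prod_norm)
  also have "\<dots> \<le> (real p / (2 * real h)) ^ k * (\<Prod>i\<in>{1..d} - {j}. real (M + 1) ^ k)"
    by (intro mult_mono power_mono Sj prod_mono prod_nonneg conjI S) auto
  finally show ?thesis
    using assms(2) by simp
qed

lemma height_dual_height_le:
  assumes "p \<ge> 2" "d \<ge> 2" "t d = 1"
  shows "real_of_int (height p d t) \<le>
           exp 1 * (real d - 1) *
             (real p * real_of_int \<lceil>ln (real p)\<rceil> / (2 * real (dual_height p d t)))"
proof (rule ccontr)
  assume contr: "\<not> ?thesis"
  define h where "h = dual_height p d t"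
  define L where "L = nat \<lceil>ln (real p)\<rceil>"
  define k where "k = (d - 1) * L"
  define q where "q = real p / (2 * real h)"
  \<comment> \<open>Rounding down keeps \<open>k * M\<close> at most \<open>k * (exp 1 * q)\<close>,
    which is the bound to be proved, while \<open>M + 1\<close> still exceeds
    \<open>exp 1 * q\<close>.\<close>
  define M where "M = nat \<lfloor>exp 1 * q\<rfloor>"
  define Q where "Q = real p ^ (d - 1)"
  define N where "N = real (M + 1)"
  define F where "F = (\<lambda>\<alpha>. \<Prod>i=1..d. (\<Sum>j\<le>M. addchar p (\<alpha> i) ^ j) ^ k)"
  define z where "z = (\<lambda>i\<in>{1..d}. 0 :: int)"

  have h: "0 < h" "2 * h \<le> p"
    using dual_height_bounds[of p d t, OF assms] by (auto simp: h_def)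
  then have q: "q \<ge> 1"
    by (simp add: q_def field_simps)
  have lnp: "ln (real p) > 0"
    using assms(1) by simp
  then have L: "real_of_int \<lceil>ln (real p)\<rceil> = real L" "L > 0"
    by (auto simp: L_def)
  have k: "real k = (real d - 1) * real L" "k > 0"
    using assms(2) L(2) by (auto simp: k_def of_nat_diff)
  have Q: "Q \<ge> 1"
    using assms(1) by (simp add: Q_def)

  have "real M \<le> exp 1 * q"
    using q by (simp add: M_def)
  then have "real (k * M) \<le> real k * (exp 1 * q)"
    by (simp add: mult_left_mono)
  also have "\<dots> < height p d t"
    using contr by (simp add: k(1) L(1) q_def h_def mult_ac)
  finally have kM: "int (k * M) < height p d t"
    by linarith
  have "k * M < p"
    using kM height_less[of p d t] assms by linarith
  moreover have "\<exists>i\<in>{1..d}. (a * t i) mod int p > int (k * M)" if "a \<in> {0<..<int p}" for a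
    using height_le[of d t a p "int (k * M)"] that assms kM by force
  ultimately have sum_F: "(\<Sum>\<alpha>\<in>orth p d t. F \<alpha>) = of_nat p ^ (d - 1)"
    unfolding F_def using assms by (intro sum_orth_power_geometric) auto

  have N: "exp 1 * q < N"
    using q by (simp add: N_def M_def) linarith
  have N_pos: "N > 0"
    by (simp add: N_def)
  \<comment> \<open>This is what dictates \<open>k\<close>: each of the \<open>d - 1\<close> factors
    \<open>p\<close> of \<open>Q\<close> is at most \<open>exp L\<close>.\<close>
  have exp_k: "Q \<le> exp 1 ^ k"
  proof -
    have "Q = exp (ln (real p)) ^ (d - 1)"
      using assms(1) by (simp add: Q_def)
    also have "\<dots> \<le> exp (real L) ^ (d - 1)"
      using L(1) le_of_int_ceiling[of "ln (real p)"] by (intro power_mono) auto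
    also have "\<dots> = exp 1 ^ k"
      by (simp add: k_def mult_ac flip: exp_of_nat_mult)
    finally show ?thesis .
  qed
  have norm_F: "norm (F \<alpha>) \<le> (N ^ k) ^ d / Q" if \<alpha>: "\<alpha> \<in> orth p d t - {z}" for \<alpha>
  proof -
    have "\<exists>i\<in>{1..d}. \<alpha> i \<noteq> 0"
    proof (rule ccontr)
      assume "\<not> ?thesis"
      with \<alpha> have "\<alpha> = z"
        by (auto simp: orth_def z_def PiE_def extensional_def fun_eq_iff)
      with \<alpha> show False
        by simp
    qed
    then obtain j where "j \<in> {1..d}" "h \<le> res_abs p (\<alpha> j)"
      using dual_height_le_res_abs \<alpha> unfolding h_def by blast
    then have "norm (F \<alpha>) \<le> q ^ k * (N ^ k) ^ (d - 1)"
      unfolding F_def q_def N_def using assms(1) h(1)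
      by (intro norm_prod_power_geometric_le) auto
    \<comment> \<open>The saving: \<open>q\<close> is smaller than \<open>N\<close> by more than a
      factor \<open>exp 1\<close>, and \<open>exp 1 ^ k\<close> is at least
      \<open>Q\<close>.\<close>
    also have "\<dots> \<le> (N ^ k / Q) * (N ^ k) ^ (d - 1)"
    proof (intro mult_right_mono)
      have "q ^ k * Q \<le> q ^ k * exp 1 ^ k"
        using exp_k q by (intro mult_left_mono) auto
      also have "\<dots> = (exp 1 * q) ^ k"
        by (simp add: power_mult_distrib)
      also have "\<dots> \<le> N ^ k"
        using N q by (intro power_mono) auto
      finally show "q ^ k \<le> N ^ k / Q"
        using Q by (simp add: field_simps)
    qed (use N_pos in auto)
    also have "\<dots> = (N ^ k) ^ d / Q"
      using assms(2) by (simp add: power_eq_if)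
    finally show ?thesis .
  qed

  have z: "z \<in> orth p d t"
    using assms(1) by (auto simp: orth_def z_def)
  have F_z: "F z = complex_of_real ((N ^ k) ^ d)"
    by (simp add: F_def z_def N_def)
  \<comment> \<open>The 1 gained by leaving out the zero vector is decisive: \<open>Q\<close> terms
    of size \<open>(N ^ k) ^ d / Q\<close> could cancel \<open>F z\<close> completely.\<close>
  have card: "real (card (orth p d t - {z})) \<le> Q - 1"
  proof -
    have "real (card (orth p d t)) \<le> Q"
      using card_orth_le[of d t p] assms(2,3) unfolding Q_def by (simp flip: of_nat_power)
    moreover have "card (orth p d t) = Suc (card (orth p d t - {z}))"
      using card.remove[OF finite_orth z] .
    ultimately show ?thesis
      by simp
  qed
  have "(N ^ k) ^ d = norm (F z)"
    unfolding F_z norm_of_real using N_pos by simp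
  also have "F z = of_nat p ^ (d - 1) - (\<Sum>\<alpha>\<in>orth p d t - {z}. F \<alpha>)"
    using sum_F by (simp add: sum.remove[OF finite_orth z] eq_diff_eq)
  also have "norm \<dots> \<le> Q + norm (\<Sum>\<alpha>\<in>orth p d t - {z}. F \<alpha>)"
    by (rule order_trans[OF norm_triangle_ineq4]) (simp add: Q_def norm_power)
  also have "norm (\<Sum>\<alpha>\<in>orth p d t - {z}. F \<alpha>) \<le> real (card (orth p d t - {z})) * ((N ^ k) ^ d / Q)"
    by (rule sum_norm_bound) (rule norm_F)
  also have "\<dots> \<le> (Q - 1) * ((N ^ k) ^ d / Q)"
    using card N_pos Q by (intro mult_right_mono) auto
  finally have "(N ^ k) ^ d \<le> Q + (Q - 1) * ((N ^ k) ^ d / Q)"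
    by simp
  \<comment> \<open>After cancellation, \<open>(N ^ k) ^ d / Q \<le> Q\<close> remains.\<close>
  then have "(N ^ k) ^ d \<le> Q ^ 2"
    using Q by (simp add: field_simps power2_eq_square)
  also have "\<dots> \<le> Q ^ d"
    using Q assms(2) by (intro power_increasing) auto
  also have "\<dots> < (N ^ k) ^ d"
  proof (rule power_strict_mono)
    have "Q \<le> exp 1 ^ k"
      by (rule exp_k)
    also have "\<dots> < N ^ k"
    proof (rule power_strict_mono)
      have "exp 1 \<le> exp 1 * q"
        using q by simp
      with N show "exp 1 < N"
        by linarith
    qed (use k(2) in auto)
    finally show "Q < N ^ k" .
  qed (use Q assms(2) in auto)
  finally show False
    by simp
qed

theorem lemma7p4:
  fixes d :: nat
  assumes "d > 2"
  shows "(\<forall>(p::nat) t. prime p \<longrightarrow> t \<in> Zp_vecs p d \<longrightarrow> t d = 1 \<longrightarrow>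
            real_of_int (height p d t) \<le>
              exp 1 * (real d - 1) *
                (real p * real_of_int \<lceil>ln (real p)\<rceil> / (2 * real (dual_height p d t)))) \<and>
         (\<exists>C::real. C > 0 \<and>
            (\<forall>(p::nat) t. prime p \<longrightarrow> t \<in> Zp_vecs p d \<longrightarrow> t d = 1 \<longrightarrow>
               real_of_int (height p d t) \<le>
                 C * (real p * ln (real p) / real (dual_height p d t))))"
proof (intro conjI exI allI impI)
  fix p :: nat and t :: "nat \<Rightarrow> int"
  assume "prime p" "t d = 1"
  then show bound: "real_of_int (height p d t) \<le>
              exp 1 * (real d - 1) *
                (real p * real_of_int \<lceil>ln (real p)\<rceil> / (2 * real (dual_height p d t)))"
    using assms by (intro height_dual_height_le) (auto simp: prime_ge_2_nat)
  \<comment> \<open>Since \<open>p \<ge> 2\<close>, the 1 lost in rounding up is at most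
    \<open>ln p / ln 2\<close>, so the ceiling costs only a constant factor.\<close>
  define c where "c = 1 + 1 / ln (2::real)"
  have "ln 2 \<le> ln (real p)"
    using prime_ge_2_nat[OF \<open>prime p\<close>] by simp
  then have "1 \<le> ln (real p) / ln 2"
    by simp
  with of_int_ceiling_le_add_one[of "ln (real p)"]
  have "real_of_int \<lceil>ln (real p)\<rceil> \<le> ln (real p) + ln (real p) / ln 2"
    by linarith
  then have "real_of_int \<lceil>ln (real p)\<rceil> \<le> ln (real p) * c"
    by (simp add: c_def distrib_left)
  then have "exp 1 * (real d - 1) *
                (real p * real_of_int \<lceil>ln (real p)\<rceil> / (2 * real (dual_height p d t))) \<le>
             exp 1 * (real d - 1) * (real p * (ln (real p) * c) / (2 * real (dual_height p d t)))"
    using assms by (intro mult_left_mono divide_right_mono) auto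
  with bound show "real_of_int (height p d t) \<le>
      (exp 1 * (real d - 1) * (1 + 1 / ln 2) / 2) * (real p * ln (real p) / real (dual_height p d t))"
    by (simp add: c_def mult_ac)
next
  show "0 < exp 1 * (real d - 1) * (1 + 1 / ln 2) / 2"
    using assms by (auto intro!: mult_pos_pos add_pos_pos)
qed

end
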